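(* Let $m,n\ge 3$ be integers with $|m-n|\ge 2$, and let $T_{m,n}=C_m\,\square\,C_n$ be the toroidal grid graph. Then its divisorial gonality is $\operatorname{gon}(T_{m,n})=2\min\{m,n\}$.
   Context: $C_n$ is the cycle on $n$ vertices. The Cartesian product $G_1\,\square\,G_2$ has vertex set $V(G_1)\times V(G_2)$, with $(v_1,v_2)$ adjacent to $(u_1,u_2)$ iff either $v_2=u_2$ and $v_1u_1\in E(G_1)$, or $v_1=u_1$ and $v_2u_2\in E(G_2)$. Let $G$ be a finite connected simple graph. $\operatorname{Div}(G)$ is the free abelian group on $V(G)$; its elements $D=\sum_{v\in V(G)}a_v\cdot(v)$, $a_v\in\mathbb Z$, are called divisors. $D$ is effective if all $a_v\ge 0$, and $\deg(D)=\sum_v a_v$. The chip-firing move with respect to a vertex $w$ replaces $D$ by the divisor obtained by decreasing the coefficient of $w$ by $\operatorname{val}(w)$ (the number of edges incident to $w$) and increasing the coefficient of each neighbor of $w$ by $1$, leaving all other coefficients unchanged. Two divisors are equivalent if one can be obtained from the other by a sequence of chip-firing moves. The rank $r(D)$ is the largest integer $r\ge 0$ such that for every effective divisor $E$ with $\deg(E)=r$, the divisor $D-E$ is equivalent to an effective divisor; if no such $r$ exists, $r(D)=-1$. The (divisorial) gonality $\operatorname{gon}(G)$ is the smallest integer $k$ such that there is a divisor $D$ on $G$ with $\deg(D)=k$ and $r(D)\ge 1$. (Equivalently: the least degree of a divisor $D$ such that for every vertex $v$, $D-(v)$ is equivalent to an effective divisor.) *)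

theory Defs
  imports "Graph_Theory.Graph_Theory" "HOL-Algebra.Free_Abelian_Groups"
begin

section \<open>Graphs\<close>

text \<open>
  A finite simple graph is a \<^locale>\<open>pair_graph\<close>: a finite, loop-free, symmetric set of
  pairs. An edge between u and v is represented by the two arcs (u, v) and (v, u), so the
  valency of a vertex is its out-degree.
\<close>

definition cycle_graph :: "nat \<Rightarrow> nat pair_pre_digraph" where
  "cycle_graph n =
     \<lparr> pverts = {..<n},
       parcs = {(i, j). i < n \<and> j < n \<and> (j = Suc i mod n \<or> i = Suc j mod n)} \<rparr>"

definition cartesian_product ::
  "'a pair_pre_digraph \<Rightarrow> 'b pair_pre_digraph \<Rightarrow> ('a \<times> 'b) pair_pre_digraph" where
  "cartesian_product G H =
     \<lparr> pverts = pverts G \<times> pverts H,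
       parcs = {((v\<^sub>1, v\<^sub>2), (u\<^sub>1, u\<^sub>2)).
          (v\<^sub>2 = u\<^sub>2 \<and> v\<^sub>2 \<in> pverts H \<and> (v\<^sub>1, u\<^sub>1) \<in> parcs G) \<or>
          (v\<^sub>1 = u\<^sub>1 \<and> v\<^sub>1 \<in> pverts G \<and> (v\<^sub>2, u\<^sub>2) \<in> parcs H)} \<rparr>"

definition toroidal_grid :: "nat \<Rightarrow> nat \<Rightarrow> (nat \<times> nat) pair_pre_digraph" where
  "toroidal_grid m n = cartesian_product (cycle_graph m) (cycle_graph n)"


section \<open>Divisors, rank and gonality\<close>

definition Div :: "'a pair_pre_digraph \<Rightarrow> ('a \<Rightarrow>\<^sub>0 int) set" where
  "Div G = carrier (free_Abelian_group (pverts G))"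

definition effective :: "('a \<Rightarrow>\<^sub>0 int) \<Rightarrow> bool" where
  "effective D \<longleftrightarrow> (\<forall>v. 0 \<le> Poly_Mapping.lookup D v)"

definition divisor_degree :: "('a \<Rightarrow>\<^sub>0 int) \<Rightarrow> int" where
  "divisor_degree D = (\<Sum>v\<in>Poly_Mapping.keys D. Poly_Mapping.lookup D v)"

definition fire :: "'a pair_pre_digraph \<Rightarrow> 'a \<Rightarrow> ('a \<Rightarrow>\<^sub>0 int) \<Rightarrow> ('a \<Rightarrow>\<^sub>0 int)" where
  "fire G w D =
     D - frag_cmul (int (out_degree (with_proj G) w)) (frag_of w)
       + (\<Sum>u \<in> {u. (w, u) \<in> parcs G}. frag_of u)"

definition chip_firing_move ::
  "'a pair_pre_digraph \<Rightarrow> ('a \<Rightarrow>\<^sub>0 int) \<Rightarrow> ('a \<Rightarrow>\<^sub>0 int) \<Rightarrow> bool" where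
  "chip_firing_move G D D' \<longleftrightarrow> (\<exists>w \<in> pverts G. D' = fire G w D)"

text \<open>
  Sequences of moves are directed, but on a finite graph firing all vertices but one undoes
  firing the remaining one, so the relation is symmetric; see \<open>div_equiv_sym\<close> below.
\<close>

definition div_equiv ::
  "'a pair_pre_digraph \<Rightarrow> ('a \<Rightarrow>\<^sub>0 int) \<Rightarrow> ('a \<Rightarrow>\<^sub>0 int) \<Rightarrow> bool" where
  "div_equiv G = (chip_firing_move G)\<^sup>*\<^sup>*"

definition rank_candidate :: "'a pair_pre_digraph \<Rightarrow> ('a \<Rightarrow>\<^sub>0 int) \<Rightarrow> int \<Rightarrow> bool" where
  "rank_candidate G D r \<longleftrightarrow> 0 \<le> r \<and>
     (\<forall>E \<in> Div G. effective E \<and> divisor_degree E = r \<longrightarrow>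
        (\<exists>F \<in> Div G. effective F \<and> div_equiv G (D - E) F))"

text \<open>
  For a non-empty graph every candidate is at most the degree of the divisor, so the
  greatest one exists as soon as there is any; see \<open>rank_candidate_le_degree\<close> below.
\<close>

definition divisor_rank :: "'a pair_pre_digraph \<Rightarrow> ('a \<Rightarrow>\<^sub>0 int) \<Rightarrow> int" where
  "divisor_rank G D =
     (if \<exists>r. rank_candidate G D r then GREATEST r. rank_candidate G D r else - 1)"

definition gonality :: "'a pair_pre_digraph \<Rightarrow> int" where
  "gonality G = (LEAST k. \<exists>D \<in> Div G. divisor_degree D = k \<and> 1 \<le> divisor_rank G D)"


section \<open>Consistency of the definitions\<close>

lemma pair_graph_cycle_graph:
  assumes "3 \<le> n"
  shows "pair_graph (cycle_graph n)"
proof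
  have "finite ({..<n} \<times> {..<n})" by simp
  then show "finite (parcs (cycle_graph n))"
    by (rule rev_finite_subset) (auto simp: cycle_graph_def)
  show "fst e \<noteq> snd e" if "e \<in> parcs (cycle_graph n)" for e
  proof
    assume "fst e = snd e"
    with that have "fst e < n" "fst e = Suc (fst e) mod n"
      by (auto simp: cycle_graph_def)
    then show False
      using assms by (cases "Suc (fst e) = n") auto
  qed
qed (auto simp: cycle_graph_def symmetric_def sym_def)

lemma pair_graph_cartesian_product:
  assumes "pair_graph G" "pair_graph H"
  shows "pair_graph (cartesian_product G H)"
proof -
  interpret G: pair_graph G by fact
  interpret H: pair_graph H by fact
  have wf: "parcs (cartesian_product G H) \<subseteq> (pverts G \<times> pverts H) \<times> (pverts G \<times> pverts H)"
    by (auto simp: cartesian_product_def dest: G.in_arcsD1 G.in_arcsD2 H.in_arcsD1 H.in_arcsD2)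
  show ?thesis
  proof
    show "finite (parcs (cartesian_product G H))"
      using wf by (rule finite_subset) (auto simp: G.pair_finite_verts H.pair_finite_verts)
    show "fst e \<noteq> snd e" if "e \<in> parcs (cartesian_product G H)" for e
      using that G.pair_no_loops H.pair_no_loops by (fastforce simp: cartesian_product_def)
    show "symmetric (with_proj (cartesian_product G H))"
      using G.pair_sym_arcs H.pair_sym_arcs
      by (auto simp: cartesian_product_def symmetric_def sym_def)
    show "finite (pverts (cartesian_product G H))"
      by (simp add: cartesian_product_def G.pair_finite_verts H.pair_finite_verts)
  qed (auto simp: cartesian_product_def dest: G.in_arcsD1 G.in_arcsD2 H.in_arcsD1 H.in_arcsD2)
qed

lemma pair_graph_toroidal_grid:
  "3 \<le> m \<Longrightarrow> 3 \<le> n \<Longrightarrow> pair_graph (toroidal_grid m n)"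
  unfolding toroidal_grid_def
  by (intro pair_graph_cartesian_product pair_graph_cycle_graph)

lemma (in pair_graph) out_degree_eq_card:
  "out_degree (with_proj G) w = card {u. (w, u) \<in> parcs G}"
proof -
  have "out_arcs (with_proj G) w = Pair w ` {u. (w, u) \<in> parcs G}"
    by (auto simp: out_arcs_def)
  then show ?thesis
    by (simp add: out_degree_def card_image inj_on_def)
qed

lemma (in pair_graph) finite_nbrs: "finite {u. (w, u) \<in> parcs G}"
  by (rule finite_subset[OF _ pair_finite_verts]) (auto dest: in_arcsD2)

lemma lookup_fire:
  assumes "pair_graph G"
  shows "Poly_Mapping.lookup (fire G w D) v =
    Poly_Mapping.lookup D v
      - (if v = w then int (out_degree (with_proj G) w) else 0)
      + (if (w, v) \<in> parcs G then 1 else 0)"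
proof -
  interpret pair_graph G by fact
  have "Poly_Mapping.lookup (\<Sum>u \<in> {u. (w, u) \<in> parcs G}. frag_of u) v
      = (\<Sum>u \<in> {u. (w, u) \<in> parcs G}. if u = v then 1 else 0)"
    by (simp add: lookup_sum lookup_single when_def eq_commute[of v])
  then show ?thesis
    using finite_nbrs[of w]
    by (simp add: fire_def lookup_add lookup_minus lookup_single when_def)
qed

lemma div_equiv_sym:
  assumes "pair_graph G" "div_equiv G D D'"
  shows "div_equiv G D' D"
proof -
  interpret pair_graph G by fact
  define L where "L w = fire G w 0" for w
  have fire_eq: "fire G w D = D + L w" for w D
    by (simp add: L_def fire_def)
  have reach: "(chip_firing_move G)\<^sup>*\<^sup>* D (D + (\<Sum>w\<in>S. L w))" if "S \<subseteq> pverts G" for S D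
  proof -
    have "finite S" using that pair_finite_verts finite_subset by blast
    then show ?thesis using that
    proof (induction S)
      case (insert w S)
      then have "chip_firing_move G (D + sum L S) (D + sum L (insert w S))"
        unfolding chip_firing_move_def fire_eq by (intro bexI[of _ w]) (auto simp: algebra_simps)
      with insert show ?case by (meson insert_subset rtranclp.rtrancl_into_rtrancl)
    qed simp
  qed
  have total: "(\<Sum>w\<in>pverts G. L w) = 0"
  proof (rule poly_mapping_eqI)
    fix v
    have arcs: "{w \<in> pverts G. (w, v) \<in> parcs G} = {u. (v, u) \<in> parcs G}"
      using pair_sym_arcs by (auto simp: symmetric_def sym_def dest: in_arcsD1 in_arcsD2)
    have "v \<notin> pverts G \<Longrightarrow> out_degree (with_proj G) v = 0"
      unfolding out_degree_eq_card using in_arcsD1 by (auto simp: card_eq_0_iff)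
    then show "Poly_Mapping.lookup (\<Sum>w\<in>pverts G. L w) v = Poly_Mapping.lookup 0 v"
      using pair_finite_verts arcs
      by (auto simp: lookup_sum L_def lookup_fire[OF assms(1)] sum.distrib sum_subtractf
          out_degree_eq_card sum.If_cases Int_def)
  qed
  have step: "(chip_firing_move G)\<^sup>*\<^sup>* D' D" if move: "chip_firing_move G D D'" for D D'
  proof -
    obtain w where w: "w \<in> pverts G" "D' = D + L w"
      using move by (auto simp: chip_firing_move_def fire_eq)
    have "D' + (\<Sum>w\<in>pverts G - {w}. L w) = D"
      using total w pair_finite_verts by (simp add: sum_diff1)
    with reach[of "pverts G - {w}" D'] show ?thesis by simp
  qed
  from assms(2) show ?thesis
    unfolding div_equiv_def
    by (induction) (auto intro: rtranclp_trans step)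
qed

lemma divisor_degree_eq:
  assumes "finite V" "Poly_Mapping.keys D \<subseteq> V"
  shows "divisor_degree D = (\<Sum>v\<in>V. Poly_Mapping.lookup D v)"
  unfolding divisor_degree_def
  by (rule sum.mono_neutral_left) (use assms in \<open>auto simp: in_keys_iff\<close>)

lemma divisor_degree_diff:
  "divisor_degree (D - E) = divisor_degree D - divisor_degree E"
proof -
  let ?V = "Poly_Mapping.keys D \<union> Poly_Mapping.keys E"
  have "Poly_Mapping.keys (D - E) \<subseteq> ?V" by (auto simp: in_keys_iff lookup_minus)
  then show ?thesis
    by (simp add: divisor_degree_eq[of ?V] lookup_minus sum_subtractf)
qed

lemma divisor_degree_fire:
  assumes "pair_graph G"
  shows "divisor_degree (fire G w D) = divisor_degree D"
proof -
  interpret pair_graph G by fact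
  let ?N = "{u. (w, u) \<in> parcs G}"
  define V where "V = Poly_Mapping.keys D \<union> Poly_Mapping.keys (fire G w D) \<union> insert w ?N"
  have V: "finite V" "w \<in> V" "V \<inter> ?N = ?N"
    using finite_nbrs[of w] by (auto simp: V_def)
  have "divisor_degree (fire G w D) = (\<Sum>v\<in>V. Poly_Mapping.lookup (fire G w D) v)"
    using V by (intro divisor_degree_eq) (auto simp: V_def)
  also have "\<dots> = (\<Sum>v\<in>V. Poly_Mapping.lookup D v)"
    using V by (simp add: lookup_fire[OF assms] sum.distrib sum_subtractf
        out_degree_eq_card sum.If_cases)
  also have "\<dots> = divisor_degree D"
    using V by (intro divisor_degree_eq[symmetric]) (auto simp: V_def)
  finally show ?thesis .
qed

lemma rank_candidate_le_degree:
  assumes "pair_graph G" "pverts G \<noteq> {}" "rank_candidate G D r"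
  shows "r \<le> divisor_degree D"
proof -
  have deg_equiv: "divisor_degree D' = divisor_degree D" if "div_equiv G D D'" for D D'
    using that unfolding div_equiv_def
    by induction (auto simp: chip_firing_move_def divisor_degree_fire[OF assms(1)])
  obtain v where v: "v \<in> pverts G" using assms(2) by blast
  define E where "E = Poly_Mapping.single v r"
  have "0 \<le> r" using assms(3) by (simp add: rank_candidate_def)
  then have "E \<in> Div G" "effective E" "divisor_degree E = r"
    using v by (auto simp: E_def Div_def effective_def divisor_degree_def lookup_single when_def)
  then obtain F where F: "effective F" "div_equiv G (D - E) F"
    using assms(3) by (auto simp: rank_candidate_def)
  have "0 \<le> divisor_degree F"
    using F(1) by (auto simp: effective_def divisor_degree_def intro: sum_nonneg)
  then show ?thesis
    using deg_equiv[OF F(2)] \<open>divisor_degree E = r\<close> by (simp add: divisor_degree_diff)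
qed

end

theory Submission
  imports Defs
begin

text \<open>
  Let \<open>m \<le> n\<close>. Two chips on every vertex of one copy of \<open>C\<^sub>m\<close> have positive rank, because the
  divisor \<open>2 (0)\<close> on \<open>C\<^sub>n\<close> is equivalent to \<open>(t) + (- t)\<close> for every \<open>t\<close>.

  The lower bound comes from the scramble whose eggs are the copies of \<open>C\<^sub>m\<close> with one vertex
  removed. Hitting all eggs takes two vertices in each of the \<open>n\<close> copies, and a cut separating
  two eggs has at least two arcs in \<open>m\<close> different rows or columns. Among the effective divisors
  equivalent to a given one of positive rank, take one that hits the most eggs. If it hits all
  of them, then its degree is at least the hitting number. Otherwise move to a divisor that hits
  a missed egg \<open>E\<close>, by firing an increasing chain of sets: the first time \<open>E\<close> is hit, some egg
  \<open>E'\<close> hit initially has been lost, and the fired set at which \<open>E'\<close> was lost contains \<open>E'\<close> and is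
  disjoint from \<open>E\<close>. That set loses a chip along each arc leaving it, so the degree is at least
  the size of a cut separating the two eggs.
\<close>

section \<open>Firing scripts\<close>

text \<open>A function \<open>f\<close> is a firing script: \<open>f v\<close> counts the firings of
  \<open>v\<close>, negative values being reverse firings, and the script turns \<open>d\<close>
  into \<open>d - laplacian G f\<close>.\<close>

definition laplacian :: "'a pair_pre_digraph \<Rightarrow> ('a \<Rightarrow> int) \<Rightarrow> 'a \<Rightarrow> int" where
  "laplacian G f v = (\<Sum>u | (v, u) \<in> parcs G. f v - f u)"

text \<open>Rank at least one for plain functions: instead of removing a chip at \<open>v\<close>,
  an equivalent effective divisor must have a chip there.\<close>

definition positive_rank :: "'a pair_pre_digraph \<Rightarrow> ('a \<Rightarrow> int) \<Rightarrow> bool" where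
  "positive_rank G d \<longleftrightarrow>
     (\<forall>v\<in>pverts G. \<exists>f. (\<forall>w\<in>pverts G. 0 \<le> d w - laplacian G f w) \<and> 0 < d v - laplacian G f v)"

lemma laplacian_add: "laplacian G (\<lambda>v. f v + g v) w = laplacian G f w + laplacian G g w"
  by (simp add: laplacian_def flip: sum.distrib) (simp add: algebra_simps)

lemma laplacian_diff: "laplacian G (\<lambda>v. f v - g v) w = laplacian G f w - laplacian G g w"
  by (simp add: laplacian_def flip: sum_subtractf) (simp add: algebra_simps)

lemma laplacian_const [simp]: "laplacian G (\<lambda>_. c) w = 0"
  by (simp add: laplacian_def)

lemma laplacian_cong:
  assumes "pair_graph G" "\<And>v. v \<in> pverts G \<Longrightarrow> f v = g v"
  shows "laplacian G f w = laplacian G g w"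
proof -
  interpret pair_graph G by fact
  show ?thesis
    unfolding laplacian_def
    using assms(2) by (intro sum.cong refl) (metis in_arcsD1 in_arcsD2 mem_Collect_eq)
qed

lemma laplacian_outside:
  assumes "pair_graph G" "w \<notin> pverts G"
  shows "laplacian G f w = 0"
proof -
  interpret pair_graph G by fact
  have "{u. (w, u) \<in> parcs G} = {}" using assms(2) in_arcsD1 by blast
  then show ?thesis by (simp add: laplacian_def)
qed

text \<open>Firing all of \<open>U\<close> once moves one chip along each arc leaving
  \<open>U\<close>; moves inside \<open>U\<close> cancel.\<close>

lemma laplacian_indicator:
  assumes "pair_graph G"
  shows "laplacian G (\<lambda>v. of_bool (v \<in> U)) w =
    (if w \<in> U then int (card {u. (w, u) \<in> parcs G \<and> u \<notin> U})
     else - int (card {u. (w, u) \<in> parcs G \<and> u \<in> U}))"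
proof -
  interpret pair_graph G by fact
  have eq: "card {u. (w, u) \<in> parcs G \<and> P u} = (\<Sum>u | (w, u) \<in> parcs G. of_bool (P u))" for P
    using finite_nbrs[of w] by (simp add: of_bool_def sum.If_cases Int_def)
  show ?thesis
    unfolding laplacian_def eq by (simp add: of_bool_def sum_negf [symmetric] if_distrib cong: if_cong)
      (auto intro!: sum.cong)
qed

text \<open>An arc and its reverse contribute opposite terms, so scripts preserve the
  degree.\<close>

lemma sum_laplacian:
  assumes "pair_graph G"
  shows "(\<Sum>v\<in>pverts G. laplacian G f v) = 0"
proof -
  interpret pair_graph G by fact
  have "(\<Sum>v\<in>pverts G. laplacian G f v) = (\<Sum>(v, u)\<in>parcs G. f v - f u)"
    unfolding laplacian_def
    by (subst sum.Sigma) (auto simp: pair_finite_verts finite_nbrs intro!: sum.cong dest: in_arcsD1)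
  also have "\<dots> = (\<Sum>(v, u)\<in>parcs G. f u - f v)"
    by (rule sum.reindex_bij_witness[of _ prod.swap prod.swap])
      (use pair_sym_arcs in \<open>auto simp: symmetric_def sym_def\<close>)
  also have "\<dots> = - (\<Sum>(v, u)\<in>parcs G. f v - f u)"
    by (auto simp: sum_negf[symmetric] intro!: sum.cong)
  finally show ?thesis
    using \<open>(\<Sum>v\<in>pverts G. laplacian G f v) = (\<Sum>(v, u)\<in>parcs G. f v - f u)\<close> by linarith
qed

lemma lookup_fire_laplacian:
  assumes "pair_graph G"
  shows "Poly_Mapping.lookup (fire G w D) v =
    Poly_Mapping.lookup D v - laplacian G (\<lambda>u. of_bool (u \<in> {w})) v"
proof -
  interpret pair_graph G by fact
  have 1: "{u. (w, u) \<in> parcs G \<and> u \<noteq> w} = {u. (w, u) \<in> parcs G}"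
    using pair_no_loops by fastforce
  have 2: "{u. (v, u) \<in> parcs G \<and> u = w} = (if (w, v) \<in> parcs G then {w} else {})"
    using pair_sym_arcs by (auto simp: symmetric_def sym_def)
  have 3: "(w, w) \<notin> parcs G"
    using pair_no_loops by fastforce
  show ?thesis
    unfolding laplacian_indicator[OF assms] lookup_fire[OF assms] out_degree_eq_card
    unfolding singleton_iff
    using 1 2 3 by (cases "v = w") simp_all
qed

section \<open>Equivalence of divisors through firing scripts\<close>

lemma div_equiv_imp_laplacian:
  assumes "pair_graph G" "div_equiv G D D'"
  obtains f where "\<And>v. Poly_Mapping.lookup D' v = Poly_Mapping.lookup D v - laplacian G f v"
proof -
  have "\<exists>f. \<forall>v. Poly_Mapping.lookup D' v = Poly_Mapping.lookup D v - laplacian G f v"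
    using assms(2) unfolding div_equiv_def
  proof induction
    case base
    show ?case by (rule exI[of _ "\<lambda>_. 0"]) simp
  next
    case (step D' D'')
    then obtain f w where
      "\<And>v. Poly_Mapping.lookup D' v = Poly_Mapping.lookup D v - laplacian G f v" "D'' = fire G w D'"
      by (auto simp: chip_firing_move_def)
    then show ?case
      by (intro exI[of _ "\<lambda>v. f v + of_bool (v \<in> {w})"])
        (simp add: laplacian_add lookup_fire_laplacian[OF assms(1)] del: singleton_iff)
  qed
  with that show thesis by blast
qed

text \<open>The firings can be made in any order, since intermediate divisors may have negative
  coefficients; hence the induction on their number.\<close>

lemma laplacian_nat_imp_div_equiv:
  fixes f :: "'a \<Rightarrow> nat"
  assumes G: "pair_graph G"
    and "\<And>v. Poly_Mapping.lookup D' v = Poly_Mapping.lookup D v - laplacian G (\<lambda>u. int (f u)) v"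
  shows "div_equiv G D D'"
  using assms(2)
proof (induction "\<Sum>v\<in>pverts G. f v" arbitrary: f D)
  case 0
  interpret pair_graph G by fact
  have "f v = 0" if "v \<in> pverts G" for v
    using 0 that pair_finite_verts by simp
  then have "laplacian G (\<lambda>u. int (f u)) v = laplacian G (\<lambda>_. 0) v" for v
    by (intro laplacian_cong[OF G]) simp
  then have "D' = D" using 0 by (intro poly_mapping_eqI) simp
  then show ?case by (simp add: div_equiv_def)
next
  case (Suc k)
  interpret pair_graph G by fact
  obtain w where w: "w \<in> pverts G" "f w \<noteq> 0"
    using Suc(2) by (metis Zero_not_Suc sum.not_neutral_contains_not_neutral)
  define g where "g = f(w := f w - 1)"
  have fg: "f v = g v + of_bool (v \<in> {w})" for v using w by (simp add: g_def)
  have "(\<Sum>v\<in>pverts G. f v) = (\<Sum>v\<in>pverts G. g v) + 1"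
    unfolding fg sum.distrib using w pair_finite_verts by (simp add: of_bool_def)
  moreover have "Poly_Mapping.lookup D' v =
      Poly_Mapping.lookup (fire G w D) v - laplacian G (\<lambda>u. int (g u)) v" for v
    using Suc(3)[of v] unfolding lookup_fire_laplacian[OF G] fg
    by (simp only: of_nat_add of_nat_of_bool laplacian_add)
  ultimately have "div_equiv G (fire G w D) D'"
    using Suc(1)[of g] Suc(2) by simp
  moreover have "chip_firing_move G D (fire G w D)"
    using w by (auto simp: chip_firing_move_def)
  ultimately show ?case
    unfolding div_equiv_def by (meson converse_rtranclp_into_rtranclp)
qed

text \<open>Constant scripts change nothing, so subtracting a lower bound of \<open>f\<close> on the
  vertices removes all reverse firings.\<close>

lemma laplacian_imp_div_equiv:
  assumes G: "pair_graph G"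
    and eq: "\<And>v. Poly_Mapping.lookup D' v = Poly_Mapping.lookup D v - laplacian G f v"
  shows "div_equiv G D D'"
proof -
  interpret pair_graph G by fact
  obtain c where c: "\<And>v. v \<in> pverts G \<Longrightarrow> c \<le> f v"
    using pair_finite_verts by (meson bdd_below.unfold bdd_below_finite finite_imageI imageI)
  have "laplacian G f v = laplacian G (\<lambda>u. int (nat (f u - c))) v" for v
  proof -
    have "laplacian G f v = laplacian G (\<lambda>u. f u - c) v"
      using laplacian_diff[of G f "\<lambda>_. c"] by simp
    also have "\<dots> = laplacian G (\<lambda>u. int (nat (f u - c))) v"
      using c by (intro laplacian_cong[OF G]) simp
    finally show ?thesis .
  qed
  with eq show ?thesis
    by (intro laplacian_nat_imp_div_equiv[OF G, where f = "\<lambda>u. nat (f u - c)"]) simp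
qed

lemma lookup_Div: "D \<in> Div G \<Longrightarrow> v \<notin> pverts G \<Longrightarrow> Poly_Mapping.lookup D v = 0"
  by (auto simp: Div_def in_keys_iff)

lemma Div_of_function:
  assumes "pair_graph G"
  obtains D where "D \<in> Div G" "\<And>v. v \<in> pverts G \<Longrightarrow> Poly_Mapping.lookup D v = d v"
proof -
  interpret pair_graph G by fact
  let ?D = "\<Sum>v\<in>pverts G. Poly_Mapping.single v (d v :: int)"
  have "Poly_Mapping.lookup ?D v = (if v \<in> pverts G then d v else 0)" for v
    using pair_finite_verts by (auto simp: lookup_sum lookup_single when_def)
  then show thesis
    by (intro that[of ?D]) (auto simp: Div_def in_keys_iff split: if_splits)
qed

section \<open>Rank and gonality in terms of integer functions\<close>

text \<open>The degree bounds the candidates, so \<open>GREATEST\<close> is a true maximum;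
  \<open>0 \<le> k\<close> excludes the default \<open>- 1\<close>.\<close>

lemma le_divisor_rank_iff:
  assumes G: "pair_graph G" and V: "pverts G \<noteq> {}" and k: "0 \<le> k"
  shows "k \<le> divisor_rank G D \<longleftrightarrow> (\<exists>r\<ge>k. rank_candidate G D r)"
proof (cases "\<exists>r. rank_candidate G D r")
  case True
  let ?R = "{r. rank_candidate G D r}"
  have "?R \<subseteq> {0..divisor_degree D}"
    using rank_candidate_le_degree[OF G V] by (auto simp: rank_candidate_def)
  then have fin: "finite ?R" using finite_subset by blast
  have "(GREATEST r. rank_candidate G D r) = Max ?R"
    using Max_in[OF fin] Max_ge[OF fin] True by (intro Greatest_equality) auto
  then show ?thesis
    using True Max_ge_iff[OF fin, of k] by (auto simp: divisor_rank_def)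
qed (use k in \<open>simp add: divisor_rank_def\<close>)

lemma one_le_divisor_rank_iff:
  assumes G: "pair_graph G" and V: "pverts G \<noteq> {}" and D: "D \<in> Div G"
  shows "1 \<le> divisor_rank G D \<longleftrightarrow> positive_rank G (Poly_Mapping.lookup D)"
proof
  interpret pair_graph G by fact
  assume rank: "1 \<le> divisor_rank G D"
  then obtain r where r: "rank_candidate G D r" "1 \<le> r"
    using le_divisor_rank_iff[OF G V] by auto
  show "positive_rank G (Poly_Mapping.lookup D)"
    unfolding positive_rank_def
  proof
    fix v assume v: "v \<in> pverts G"
    \<comment> \<open>The candidate \<open>r\<close> may exceed 1, so all \<open>r\<close> chips are
      taken from \<open>v\<close>; giving them back leaves a chip there.\<close>
    define E where "E = Poly_Mapping.single v r"
    have "E \<in> Div G" "effective E" "divisor_degree E = r"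
      using v r by (auto simp: E_def Div_def effective_def divisor_degree_def lookup_single when_def)
    then obtain F where F: "effective F" "div_equiv G (D - E) F"
      using r(1) by (auto simp: rank_candidate_def)
    obtain f where "\<And>w. Poly_Mapping.lookup F w = Poly_Mapping.lookup (D - E) w - laplacian G f w"
      using div_equiv_imp_laplacian[OF G F(2)] by blast
    then have "Poly_Mapping.lookup D w - laplacian G f w =
        Poly_Mapping.lookup F w + (if w = v then r else 0)" for w
      by (auto simp: E_def lookup_minus lookup_single when_def)
    then show "\<exists>f. (\<forall>w\<in>pverts G. 0 \<le> Poly_Mapping.lookup D w - laplacian G f w) \<and>
        0 < Poly_Mapping.lookup D v - laplacian G f v"
      using F(1) r(2) by (intro exI[of _ f]) (auto simp: effective_def add_nonneg_pos)
  qed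
next
  interpret pair_graph G by fact
  assume pos: "positive_rank G (Poly_Mapping.lookup D)"
  have "rank_candidate G D 1"
    unfolding rank_candidate_def
  proof (intro conjI ballI impI)
    fix E assume E: "E \<in> Div G" "effective E \<and> divisor_degree E = 1"
    have "(\<Sum>v\<in>Poly_Mapping.keys E. Poly_Mapping.lookup E v) = 1"
      using E by (simp add: divisor_degree_def)
    then obtain v where v: "v \<in> Poly_Mapping.keys E"
      by (metis sum.empty zero_neq_one all_not_in_conv)
    have nonneg: "0 \<le> Poly_Mapping.lookup E w" for w
      using E by (simp add: effective_def)
    have vpos: "1 \<le> Poly_Mapping.lookup E v"
      using v nonneg[of v] by (simp add: in_keys_iff)
    have rest: "(\<Sum>w\<in>Poly_Mapping.keys E - {v}. Poly_Mapping.lookup E w)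
        = 1 - Poly_Mapping.lookup E v"
      using v \<open>sum _ _ = 1\<close> by (simp add: sum_diff1)
    then have "Poly_Mapping.lookup E v = 1"
      using vpos nonneg sum_nonneg[of "Poly_Mapping.keys E - {v}" "Poly_Mapping.lookup E"] by simp
    then have zero: "Poly_Mapping.lookup E w = 0" if "w \<noteq> v" for w
      using rest that nonneg by (auto simp: sum_nonneg_eq_0_iff in_keys_iff)
    have "v \<in> pverts G" using v E(1) by (auto simp: Div_def)
    then obtain f where f: "\<And>w. w \<in> pverts G \<Longrightarrow> 0 \<le> Poly_Mapping.lookup D w - laplacian G f w"
      "0 < Poly_Mapping.lookup D v - laplacian G f v"
      using pos unfolding positive_rank_def by blast
    obtain F where F: "F \<in> Div G" "\<And>w. w \<in> pverts G \<Longrightarrow>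
        Poly_Mapping.lookup F w = Poly_Mapping.lookup (D - E) w - laplacian G f w"
      using Div_of_function[OF G, of "\<lambda>w. Poly_Mapping.lookup (D - E) w - laplacian G f w"] by blast
    \<comment> \<open>Off the vertex set every term vanishes.\<close>
    have F': "Poly_Mapping.lookup F w = Poly_Mapping.lookup (D - E) w - laplacian G f w" for w
      using F lookup_Div[OF D] lookup_Div[OF E(1)] lookup_Div[OF F(1)] laplacian_outside[OF G]
      by (cases "w \<in> pverts G") (auto simp: lookup_minus)
    have "effective F"
      unfolding effective_def
    proof
      fix w
      show "0 \<le> Poly_Mapping.lookup F w"
        using F'[of w] f lookup_Div[OF F(1), of w] zero[of w] \<open>Poly_Mapping.lookup E v = 1\<close>
        by (cases "w \<in> pverts G"; cases "w = v") (force simp: lookup_minus)+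
    qed
    with F F' show "\<exists>F\<in>Div G. effective F \<and> div_equiv G (D - E) F"
      using laplacian_imp_div_equiv[OF G] by blast
  qed simp
  then show "1 \<le> divisor_rank G D"
    using le_divisor_rank_iff[OF G V] by auto
qed

lemma gonality_eq_Least:
  assumes G: "pair_graph G" and V: "pverts G \<noteq> {}"
  shows "gonality G = (LEAST k. \<exists>d. positive_rank G d \<and> (\<Sum>v\<in>pverts G. d v) = k)"
proof -
  interpret pair_graph G by fact
  have "(\<exists>D\<in>Div G. divisor_degree D = k \<and> 1 \<le> divisor_rank G D) \<longleftrightarrow>
      (\<exists>d. positive_rank G d \<and> (\<Sum>v\<in>pverts G. d v) = k)" (is "?L \<longleftrightarrow> ?R") for k
  proof
    assume ?L
    then show ?R
      using one_le_divisor_rank_iff[OF G V] divisor_degree_eq[OF pair_finite_verts]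
      by (auto simp: Div_def)
  next
    assume ?R
    then obtain d where d: "positive_rank G d" "(\<Sum>v\<in>pverts G. d v) = k" by blast
    obtain D where D: "D \<in> Div G" "\<And>v. v \<in> pverts G \<Longrightarrow> Poly_Mapping.lookup D v = d v"
      using Div_of_function[OF G, of d] by blast
    have "positive_rank G (Poly_Mapping.lookup D)"
      using d(1) D(2) by (simp add: positive_rank_def)
    moreover have "divisor_degree D = k"
      using d(2) D divisor_degree_eq[OF pair_finite_verts, of D] by (simp add: Div_def)
    ultimately show ?L
      using one_le_divisor_rank_iff[OF G V D(1)] D(1) by blast
  qed
  then show ?thesis by (simp add: gonality_def)
qed


section \<open>Scrambles\<close>

text \<open>The last clause is connectedness of the induced subgraph, in the form needed for eggs
  split by a fired set.\<close>

definition egg :: "'a pair_pre_digraph \<Rightarrow> 'a set \<Rightarrow> bool" where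
  "egg G E \<longleftrightarrow> E \<noteq> {} \<and> E \<subseteq> pverts G \<and>
     (\<forall>A. A \<inter> E \<noteq> {} \<longrightarrow> \<not> E \<subseteq> A \<longrightarrow> (\<exists>u\<in>E \<inter> A. \<exists>v\<in>E - A. (u, v) \<in> parcs G))"

definition cut_arcs :: "'a pair_pre_digraph \<Rightarrow> 'a set \<Rightarrow> ('a \<times> 'a) set" where
  "cut_arcs G U = {(u, v) \<in> parcs G. u \<in> U \<and> v \<notin> U}"

definition hits :: "('a \<Rightarrow> int) \<Rightarrow> 'a set \<Rightarrow> bool" where
  "hits d E \<longleftrightarrow> (\<exists>v\<in>E. 0 < d v)"

text \<open>
  \<open>e v\<close> is the stage after which \<open>v\<close> starts to fire, so that the truncated difference
  \<open>i - e v\<close> counts the firings of \<open>v\<close> in the first \<open>i\<close> stages; every stage fires a superset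
  of the set fired in the previous one.
\<close>

definition stage :: "'a pair_pre_digraph \<Rightarrow> ('a \<Rightarrow> int) \<Rightarrow> ('a \<Rightarrow> nat) \<Rightarrow> nat \<Rightarrow> 'a \<Rightarrow> int" where
  "stage G d e i w = d w - laplacian G (\<lambda>v. int (i - e v)) w"

lemma stage_0 [simp]: "stage G d e 0 = d"
  by (simp add: stage_def fun_eq_iff)

lemma stage_Suc:
  "stage G d e (Suc i) w = stage G d e i w - laplacian G (\<lambda>v. of_bool (v \<in> {v. e v \<le> i})) w"
proof -
  have "int (Suc i - e v) = int (i - e v) + of_bool (v \<in> {v. e v \<le> i})" for v
    by auto
  then show ?thesis
    unfolding stage_def by (simp only: laplacian_add)
qed

text \<open>The chips on \<open>w\<close> do not decrease until \<open>w\<close> starts to fire, and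
  do not increase afterwards because no neighbour then fires more often; the minimum is at an
  end.\<close>

lemma stage_nonneg:
  assumes G: "pair_graph G" and w: "w \<in> pverts G" and i: "i \<le> K"
    and e: "\<And>v. v \<in> pverts G \<Longrightarrow> e v \<le> K"
    and ends: "0 \<le> d w" "0 \<le> stage G d e K w"
  shows "0 \<le> stage G d e i w"
proof -
  interpret pair_graph G by fact
  show ?thesis
  proof (cases "i \<le> e w")
    case True
    then have "laplacian G (\<lambda>v. int (i - e v)) w \<le> 0"
      unfolding laplacian_def by (intro sum_nonpos) auto
    with ends(1) show ?thesis by (simp add: stage_def)
  next
    case False
    have "laplacian G (\<lambda>v. int (i - e v)) w \<le> laplacian G (\<lambda>v. int (K - e v)) w"
      unfolding laplacian_def
    proof (intro sum_mono)
      fix u assume "u \<in> {u. (w, u) \<in> parcs G}"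
      then have "e u \<le> K" using e in_arcsD2 by blast
      then show "int (i - e w) - int (i - e u) \<le> int (K - e w) - int (K - e u)"
        using False i by linarith
    qed
    with ends(2) show ?thesis by (simp add: stage_def)
  qed
qed

lemma stage_Suc_ge:
  assumes "pair_graph G" "i < e w"
  shows "stage G d e i w \<le> stage G d e (Suc i) w"
  unfolding stage_Suc laplacian_indicator[OF assms(1)] using assms(2) by simp

lemma stage_Suc_le:
  assumes "pair_graph G" "e w \<le> i"
  shows "stage G d e (Suc i) w \<le> stage G d e i w"
  unfolding stage_Suc laplacian_indicator[OF assms(1)] using assms(2) by simp

text \<open>
  An egg that is split by a fired set contains both ends of an arc along which a chip moves,
  so it is hit before and after the firing.
\<close>

lemma split_egg_hit:
  assumes G: "pair_graph G" and E: "egg G E"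
    and nonneg: "\<And>w. w \<in> pverts G \<Longrightarrow> 0 \<le> stage G d e i w"
      "\<And>w. w \<in> pverts G \<Longrightarrow> 0 \<le> stage G d e (Suc i) w"
    and split: "\<exists>v\<in>E. e v \<le> i" "\<exists>v\<in>E. i < e v"
  shows "hits (stage G d e i) E" "hits (stage G d e (Suc i)) E"
proof -
  interpret pair_graph G by fact
  let ?U = "{v. e v \<le> i}"
  obtain u v where uv: "u \<in> E" "e u \<le> i" "v \<in> E" "i < e v" "(u, v) \<in> parcs G"
  proof -
    have "?U \<inter> E \<noteq> {}" "\<not> E \<subseteq> ?U" using split by auto
    then obtain u v where "u \<in> E \<inter> ?U" "v \<in> E - ?U" "(u, v) \<in> parcs G"
      using E unfolding egg_def by metis
    then show thesis by (intro that[of u v]) auto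
  qed
  then have vu: "(v, u) \<in> parcs G" "u \<in> pverts G" "v \<in> pverts G"
    using pair_sym_arcs by (auto simp: symmetric_def sym_def dest: in_arcsD1 in_arcsD2)
  have "0 < card {x. (u, x) \<in> parcs G \<and> x \<notin> ?U}" "0 < card {x. (v, x) \<in> parcs G \<and> x \<in> ?U}"
    using uv vu finite_nbrs[of u] finite_nbrs[of v] by (auto simp: card_gt_0_iff)
  then have "0 < stage G d e i u" "0 < stage G d e (Suc i) v"
    using stage_Suc[of G d e i u] stage_Suc[of G d e i v] nonneg[of u] nonneg[of v] uv vu
    unfolding laplacian_indicator[OF G] by (simp_all del: card_gt_0_iff)
  then show "hits (stage G d e i) E" "hits (stage G d e (Suc i)) E"
    using uv unfolding hits_def by blast+
qed

section \<open>Lower bounds for the degree\<close>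

text \<open>Each vertex of \<open>U\<close> pays one chip per arc leaving \<open>U\<close>, and must
  own these chips beforehand since no debt results.\<close>

lemma card_cut_arcs_le:
  assumes G: "pair_graph G"
    and nonneg: "\<And>w. w \<in> pverts G \<Longrightarrow> 0 \<le> d w"
      "\<And>w. w \<in> pverts G \<Longrightarrow> 0 \<le> d w - laplacian G (\<lambda>v. of_bool (v \<in> U)) w"
  shows "int (card (cut_arcs G U)) \<le> (\<Sum>v\<in>pverts G. d v)"
proof -
  interpret pair_graph G by fact
  have "cut_arcs G U = Sigma (pverts G \<inter> U) (\<lambda>u. {v. (u, v) \<in> parcs G \<and> v \<notin> U})"
    by (auto simp: cut_arcs_def dest: in_arcsD1)
  then have "int (card (cut_arcs G U)) =
      (\<Sum>u\<in>pverts G \<inter> U. int (card {v. (u, v) \<in> parcs G \<and> v \<notin> U}))"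
    using finite_nbrs pair_finite_verts by simp
  also have "\<dots> \<le> (\<Sum>u\<in>pverts G \<inter> U. d u)"
  proof (intro sum_mono)
    fix u assume "u \<in> pverts G \<inter> U"
    then show "int (card {v. (u, v) \<in> parcs G \<and> v \<notin> U}) \<le> d u"
      using nonneg(2)[of u] by (simp add: laplacian_indicator[OF G])
  qed
  also have "\<dots> \<le> (\<Sum>u\<in>pverts G. d u)"
    using nonneg(1) pair_finite_verts by (intro sum_mono2) auto
  finally show ?thesis .
qed

lemma positive_rank_minus_laplacian:
  assumes "positive_rank G d" "\<And>w. w \<in> pverts G \<Longrightarrow> d' w = d w - laplacian G g w"
  shows "positive_rank G d'"
  unfolding positive_rank_def
proof
  fix v assume v: "v \<in> pverts G"
  then obtain f where f: "\<forall>w\<in>pverts G. 0 \<le> d w - laplacian G f w" "0 < d v - laplacian G f v"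
    using assms(1) unfolding positive_rank_def by blast
  have "d' w - laplacian G (\<lambda>u. f u - g u) w = d w - laplacian G f w" if "w \<in> pverts G" for w
    using assms(2)[OF that] by (simp add: laplacian_diff)
  with f v show "\<exists>f. (\<forall>w\<in>pverts G. 0 \<le> d' w - laplacian G f w) \<and> 0 < d' v - laplacian G f v"
    by (intro exI[of _ "\<lambda>u. f u - g u"]) simp
qed

text \<open>\<open>k\<close> is any lower bound for the order of the scramble, that is, for both its
  hitting number and its egg-cut number.\<close>

lemma scramble_order_le_degree:
  fixes k :: int
  assumes G: "pair_graph G" and V: "pverts G \<noteq> {}"
    and pos: "positive_rank G d"
    and eggs: "\<And>E. E \<in> S \<Longrightarrow> egg G E"
    and hitting: "\<And>A. A \<subseteq> pverts G \<Longrightarrow> (\<And>E. E \<in> S \<Longrightarrow> E \<inter> A \<noteq> {}) \<Longrightarrow> k \<le> int (card A)"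
    and cut: "\<And>E E' U. E \<in> S \<Longrightarrow> E' \<in> S \<Longrightarrow> E \<subseteq> U \<Longrightarrow> E' \<inter> U = {} \<Longrightarrow>
      k \<le> int (card (cut_arcs G U))"
  shows "k \<le> (\<Sum>v\<in>pverts G. d v)"
proof -
  interpret pair_graph G by fact
  have "S \<subseteq> Pow (pverts G)" using eggs by (auto simp: egg_def)
  then have finS: "finite S" using pair_finite_verts finite_subset by blast
  \<comment> \<open>\<open>Q\<close> describes the effective divisors equivalent to
    \<open>d\<close>.\<close>
  define Q where "Q x \<longleftrightarrow>
    (\<exists>f. \<forall>w\<in>pverts G. x w = d w - laplacian G f w) \<and> (\<forall>w\<in>pverts G. 0 \<le> x w)" for x
  have sum_Q: "(\<Sum>v\<in>pverts G. x v) = (\<Sum>v\<in>pverts G. d v)" if x: "Q x" for x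
  proof -
    obtain f where "\<forall>w\<in>pverts G. x w = d w - laplacian G f w" using x by (auto simp: Q_def)
    then have "(\<Sum>v\<in>pverts G. x v) = (\<Sum>v\<in>pverts G. d v - laplacian G f v)"
      by (intro sum.cong) auto
    then show ?thesis using sum_laplacian[OF G, of f] by (simp add: sum_subtractf)
  qed
  define hit where "hit x = {E \<in> S. hits x E}" for x :: "'a \<Rightarrow> int"
  obtain v\<^sub>0 where "v\<^sub>0 \<in> pverts G" using V by blast
  then obtain f\<^sub>0 where f0: "\<forall>w\<in>pverts G. 0 \<le> d w - laplacian G f\<^sub>0 w"
    using pos unfolding positive_rank_def by blast
  have "Q (\<lambda>w. d w - laplacian G f\<^sub>0 w)"
    unfolding Q_def using f0 by blast
  moreover have "\<forall>x. Q x \<longrightarrow> card (hit x) < Suc (card S)"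
    using card_mono[OF finS] by (auto simp: hit_def less_Suc_eq_le)
  ultimately obtain x where x: "Q x" and max: "\<And>y. Q y \<Longrightarrow> card (hit y) \<le> card (hit x)"
    using ex_has_greatest_nat[of Q _ "\<lambda>x. card (hit x)"] by blast
  have xnn: "0 \<le> x w" if "w \<in> pverts G" for w using x that by (auto simp: Q_def)
  show ?thesis
  proof (cases "\<forall>E\<in>S. hits x E")
    case True
    let ?A = "{v \<in> pverts G. 0 < x v}"
    have "k \<le> int (card ?A)"
      using True eggs by (intro hitting) (fastforce simp: hits_def egg_def)+
    also have "\<dots> = (\<Sum>v\<in>?A. 1)" by simp
    also have "\<dots> \<le> (\<Sum>v\<in>?A. x v)" by (intro sum_mono) auto
    also have "\<dots> \<le> (\<Sum>v\<in>pverts G. x v)"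
      using pair_finite_verts xnn by (intro sum_mono2) auto
    finally show ?thesis using sum_Q[OF x] by simp
  next
    case False
    then obtain E where E: "E \<in> S" "\<not> hits x E" by blast
    then obtain v where v: "v \<in> E" "v \<in> pverts G" using eggs[of E] by (auto simp: egg_def)
    obtain g where g: "\<forall>w\<in>pverts G. x w = d w - laplacian G g w" using x by (auto simp: Q_def)
    have "positive_rank G x" using positive_rank_minus_laplacian[OF pos, of x g] g by blast
    then obtain f where f: "\<And>w. w \<in> pverts G \<Longrightarrow> 0 \<le> x w - laplacian G f w"
      "0 < x v - laplacian G f v"
      using v unfolding positive_rank_def by blast
    have fin: "finite (f ` pverts G)" using pair_finite_verts by simp
    \<comment> \<open>Vertices with the largest \<open>f\<close> start first. On vertices
      \<open>K - e w\<close> differs from \<open>f w\<close> by a constant, so \<open>K\<close>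
      stages have the effect of \<open>f\<close>.\<close>
    define e where "e w = nat (Max (f ` pverts G) - f w)" for w
    define K where "K = Max (e ` pverts G)"
    have eK: "e w \<le> K" if "w \<in> pverts G" for w
      unfolding K_def using that pair_finite_verts by simp
    define y where "y = stage G x e"
    have yK: "y K w = x w - laplacian G f w" for w
    proof -
      have "int (K - e u) = f u - (Max (f ` pverts G) - int K)" if "u \<in> pverts G" for u
        using eK[OF that] Max_ge[OF fin, of "f u"] that by (simp add: e_def of_nat_diff)
      then have "laplacian G (\<lambda>u. int (K - e u)) w =
          laplacian G (\<lambda>u. f u - (Max (f ` pverts G) - int K)) w"
        by (rule laplacian_cong[OF G])
      then show ?thesis
        using laplacian_diff[of G f "\<lambda>_. Max (f ` pverts G) - int K"] by (simp add: y_def stage_def)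
    qed
    have ynn: "0 \<le> y i w" if "w \<in> pverts G" "i \<le> K" for i w
      using stage_nonneg[OF G, of w i K e x] that eK xnn[OF that(1)] yK[of w] f(1)[OF that(1)]
      by (simp add: y_def)
    have Qy: "Q (y i)" if "i \<le> K" for i
      unfolding Q_def
    proof (intro conjI exI ballI)
      fix w assume "w \<in> pverts G"
      then show "y i w = d w - laplacian G (\<lambda>v. g v + int (i - e v)) w"
        using g by (simp add: y_def stage_def laplacian_add)
    qed (use ynn that in auto)
    define j where "j = (LEAST i. hits (y i) E)"
    have hitK: "hits (y K) E" using yK f(2) v by (auto simp: hits_def)
    have hit_j: "hits (y j) E" unfolding j_def using hitK by (rule LeastI)
    have jK: "j \<le> K" unfolding j_def using hitK by (rule Least_le)
    have not_hit: "\<not> hits (y i) E" if "i < j" for i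
      using that not_less_Least unfolding j_def by blast
    obtain j' where j': "j = Suc j'"
      using hit_j E(2) by (cases j) (auto simp: y_def)
    \<comment> \<open>If \<open>E\<close> met the set fired at \<open>j'\<close>, it would be hit at
      \<open>j'\<close> already: a split egg is hit before the firing, and an egg fired as a whole
      gains no chip.\<close>
    have E_late: "j' < e u" if u: "u \<in> E" for u
    proof (rule ccontr)
      assume "\<not> j' < e u"
      then have early: "\<exists>v\<in>E. e v \<le> j'" using u by (meson not_less)
      have "\<not> (\<exists>v\<in>E. j' < e v)"
        using split_egg_hit(1)[OF G eggs[OF E(1)] _ _ early, of x] ynn[of _ j'] ynn[of _ "Suc j'"]
          not_hit[of j'] jK unfolding y_def j' by (meson Suc_leD lessI)
      then have "y j w \<le> y j' w" if "w \<in> E" for w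
        using stage_Suc_le[OF G, of e w j' x] that by (force simp: y_def j')
      then have "hits (y j') E" using hit_j by (force simp: hits_def)
      then show False using not_hit[of j'] j' by simp
    qed
    \<comment> \<open>By maximality of \<open>x\<close>, gaining \<open>E\<close> must be paid for
      by losing another egg.\<close>
    have "\<not> hit x \<subset> hit (y j)"
      using max[OF Qy[OF jK]] psubset_card_mono[of "hit (y j)" "hit x"] finS by (fastforce simp: hit_def)
    moreover have "E \<in> hit (y j) - hit x" using E hit_j by (auto simp: hit_def)
    ultimately obtain E' where E': "E' \<in> S" "hits (y 0) E'" "\<not> hits (y j) E'"
      by (auto simp: hit_def y_def)
    then obtain i where i: "i < j" "hits (y i) E'" "\<not> hits (y (Suc i)) E'"
      using ex_least_nat_less[of "\<lambda>i. \<not> hits (y i) E'" j] by auto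
    let ?U = "{u. e u \<le> i}"
    obtain u where u: "u \<in> E'" "0 < y i u" using i(2) by (auto simp: hits_def)
    \<comment> \<open>Unfired vertices lose no chips, so losing \<open>E'\<close> means that it
      meets the fired set; a split egg stays hit, so the set contains all of
      \<open>E'\<close>.\<close>
    then have early: "\<exists>v\<in>E'. e v \<le> i"
      using stage_Suc_ge[OF G, of i e u x] i(3) unfolding y_def hits_def
      by (meson linorder_not_le order_less_le_trans)
    have "\<not> (\<exists>v\<in>E'. i < e v)"
      using split_egg_hit(2)[OF G eggs[OF E'(1)] _ _ early, of x] ynn[of _ i] ynn[of _ "Suc i"]
        i jK unfolding y_def by (meson Suc_leI less_imp_le order_trans)
    then have "E' \<subseteq> ?U" by (auto simp: not_less)
    \<comment> \<open>The fired sets increase, and \<open>E\<close> is still untouched at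
      \<open>j' \<ge> i\<close>.\<close>
    moreover have "E \<inter> ?U = {}" using E_late i(1) by (force simp: j')
    ultimately have "k \<le> int (card (cut_arcs G ?U))" by (rule cut[OF E'(1) E(1)])
    also have "\<dots> \<le> (\<Sum>v\<in>pverts G. y i v)"
      using ynn[of _ i] ynn[of _ "Suc i"] i jK
      by (intro card_cut_arcs_le[OF G]) (auto simp: y_def simp flip: stage_Suc[unfolded mem_Collect_eq])
    finally show ?thesis using sum_Q[OF Qy[of i]] i(1) jK by simp
  qed
qed


section \<open>Cartesian products\<close>

lemma laplacian_swap:
  "laplacian (cartesian_product H G) (f \<circ> prod.swap) w
     = laplacian (cartesian_product G H) f (prod.swap w)"
  unfolding laplacian_def
  by (rule sum.reindex_bij_witness[of _ prod.swap prod.swap])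
    (auto simp: cartesian_product_def)

lemma positive_rank_swap:
  assumes "positive_rank (cartesian_product G H) d"
  shows "positive_rank (cartesian_product H G) (d \<circ> prod.swap)"
  unfolding positive_rank_def
proof
  fix v assume "v \<in> pverts (cartesian_product H G)"
  then have "prod.swap v \<in> pverts (cartesian_product G H)"
    by (auto simp: cartesian_product_def)
  then obtain f where
    f: "\<forall>w\<in>pverts (cartesian_product G H). 0 \<le> d w - laplacian (cartesian_product G H) f w"
      "0 < d (prod.swap v) - laplacian (cartesian_product G H) f (prod.swap v)"
    using assms unfolding positive_rank_def by blast
  have "prod.swap w \<in> pverts (cartesian_product G H)"
    if "w \<in> pverts (cartesian_product H G)" for w
    using that by (auto simp: cartesian_product_def)
  with f show "\<exists>f. (\<forall>w\<in>pverts (cartesian_product H G).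
        0 \<le> (d \<circ> prod.swap) w - laplacian (cartesian_product H G) f w) \<and>
      0 < (d \<circ> prod.swap) v - laplacian (cartesian_product H G) f v"
    by (intro exI[of _ "f \<circ> prod.swap"]) (auto simp: laplacian_swap)
qed

lemma sum_cartesian_product_swap:
  "(\<Sum>v\<in>pverts (cartesian_product H G). (d \<circ> prod.swap) v)
     = (\<Sum>v\<in>pverts (cartesian_product G H). d v)"
  by (rule sum.reindex_bij_witness[of _ prod.swap prod.swap])
    (auto simp: cartesian_product_def)

text \<open>Exchanging the coordinates is an isomorphism; this reduces the theorem to
  \<open>m \<le> n\<close>.\<close>

lemma gonality_cartesian_product_commute:
  assumes G: "pair_graph G" "pverts G \<noteq> {}" and H: "pair_graph H" "pverts H \<noteq> {}"
  shows "gonality (cartesian_product G H) = gonality (cartesian_product H G)"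
proof -
  have "(\<exists>d. positive_rank (cartesian_product G H) d \<and>
        (\<Sum>v\<in>pverts (cartesian_product G H). d v) = k) \<longleftrightarrow>
      (\<exists>d. positive_rank (cartesian_product H G) d \<and>
        (\<Sum>v\<in>pverts (cartesian_product H G). d v) = k)" for k
    using positive_rank_swap sum_cartesian_product_swap by metis
  moreover have "pverts (cartesian_product G H) \<noteq> {}" "pverts (cartesian_product H G) \<noteq> {}"
    using G(2) H(2) by (auto simp: cartesian_product_def)
  ultimately show ?thesis
    using G(1) H(1) by (simp add: gonality_eq_Least pair_graph_cartesian_product)
qed

lemma laplacian_cartesian_product:
  assumes G: "pair_graph G" and H: "pair_graph H" and a: "a \<in> pverts G" and b: "b \<in> pverts H"
  shows "laplacian (cartesian_product G H) f (a, b) =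
    laplacian G (\<lambda>x. f (x, b)) a + laplacian H (\<lambda>y. f (a, y)) b"
proof -
  interpret G: pair_graph G by fact
  interpret H: pair_graph H by fact
  let ?A = "(\<lambda>x. (x, b)) ` {x. (a, x) \<in> parcs G}" and ?B = "(\<lambda>y. (a, y)) ` {y. (b, y) \<in> parcs H}"
  have nbrs: "{u. ((a, b), u) \<in> parcs (cartesian_product G H)} = ?A \<union> ?B"
    using a b by (auto simp: cartesian_product_def)
  have "(a, a) \<notin> parcs G" using G.pair_no_loops by fastforce
  then have "?A \<inter> ?B = {}" by auto
  then show ?thesis
    unfolding laplacian_def nbrs using G.finite_nbrs H.finite_nbrs
    by (subst sum.union_disjoint) (auto simp: sum.reindex inj_on_def)
qed

text \<open>A script on \<open>H\<close> is repeated on every copy of \<open>H\<close>; being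
  constant on the copies of \<open>G\<close>, it has no net effect along them.\<close>

lemma positive_rank_cartesian_product:
  assumes G: "pair_graph G" and H: "pair_graph H" and pos: "positive_rank H d"
  shows "positive_rank (cartesian_product G H) (\<lambda>v. d (snd v))"
  unfolding positive_rank_def
proof
  fix v assume "v \<in> pverts (cartesian_product G H)"
  then have "snd v \<in> pverts H" by (auto simp: cartesian_product_def)
  then obtain f where "\<forall>w\<in>pverts H. 0 \<le> d w - laplacian H f w" "0 < d (snd v) - laplacian H f (snd v)"
    using pos unfolding positive_rank_def by blast
  moreover have "laplacian (cartesian_product G H) (\<lambda>v. f (snd v)) w = laplacian H f (snd w)"
    if "w \<in> pverts (cartesian_product G H)" for w
    using that laplacian_cartesian_product[OF G H, of "fst w" "snd w" "\<lambda>v. f (snd v)"]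
    by (auto simp: cartesian_product_def)
  ultimately show "\<exists>f. (\<forall>w\<in>pverts (cartesian_product G H).
        0 \<le> d (snd w) - laplacian (cartesian_product G H) f w) \<and>
      0 < d (snd v) - laplacian (cartesian_product G H) f v"
    using \<open>v \<in> _\<close> by (intro exI[of _ "\<lambda>v. f (snd v)"]) (auto simp: cartesian_product_def)
qed


section \<open>Cycles\<close>

lemma pverts_cycle_graph [simp]: "pverts (cycle_graph n) = {..<n}"
  by (simp add: cycle_graph_def)

lemma laplacian_cycle_graph:
  assumes n: "3 \<le> n" and c: "c < n"
  shows "laplacian (cycle_graph n) f c =
    2 * f c - f (if Suc c = n then 0 else Suc c) - f (if c = 0 then n - 1 else c - 1)"
proof -
  let ?s = "if Suc c = n then 0 else Suc c" and ?p = "if c = 0 then n - 1 else c - 1"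
  have suc: "Suc i mod n = (if Suc i = n then 0 else Suc i)" if "i < n" for i
    using that by auto
  have "{u. (c, u) \<in> parcs (cycle_graph n)} = {?s, ?p}"
    using n c by (auto simp: cycle_graph_def suc cong: conj_cong split: if_splits)
  moreover have "?s \<noteq> ?p" using n c by (auto split: if_splits)
  ultimately show ?thesis by (simp add: laplacian_def)
qed

lemma positive_rank_cycle_graph:
  assumes n: "3 \<le> n"
  shows "positive_rank (cycle_graph n) (\<lambda>c. if c = 0 then 2 else 0)"
  unfolding positive_rank_def
proof
  fix t assume t: "t \<in> pverts (cycle_graph n)"
  \<comment> \<open>\<open>j\<close> is the distance of \<open>t\<close> from \<open>0\<close> on
    the cycle; \<open>f\<close> fires each vertex by the amount its own distance falls short of
    \<open>j\<close>, truncated at 0.\<close>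
  define j where "j = min t (n - t)"
  define f where "f c = int (j - min c (n - c))" for c
  have "0 \<le> (if c = 0 then 2 else 0) - laplacian (cycle_graph n) f c \<and>
      (c = t \<longrightarrow> 0 < (if c = 0 then 2 else 0) - laplacian (cycle_graph n) f c)"
    if c: "c < n" for c
  proof (cases c)
    case 0
    have "f 0 = int j" "int j - 1 \<le> f 1" "int j - 1 \<le> f (n - 1)" "t = 0 \<longrightarrow> int j = 0"
      using n by (auto simp: f_def j_def)
    then show ?thesis
      using n 0 by (auto simp: laplacian_cycle_graph f_def)
  next
    case (Suc b)
    define x y z where "x = min c (n - c)" and "y = min (Suc c) (n - Suc c)" and "z = min b (n - b)"
    \<comment> \<open>This covers the wrap-around neighbour of \<open>n - 1\<close>.\<close>
    have "f n = f 0" by (simp add: f_def)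
    then have lap: "(if c = 0 then 2 else 0) - laplacian (cycle_graph n) f c =
        int (j - y) + int (j - z) - 2 * int (j - x)"
      using Suc c by (simp add: laplacian_cycle_graph[OF n] f_def x_def y_def z_def)
    have "2 * (j - x) \<le> (j - y) + (j - z) \<and> (c = t \<longrightarrow> 2 * (j - x) < (j - y) + (j - z))"
    proof -
      have "y \<le> Suc c" "y \<le> n - Suc c" "z \<le> b" "z \<le> n - b" by (auto simp: y_def z_def)
      \<comment> \<open>Away from \<open>0\<close> the distance is concave, as a minimum of two
        linear functions, so its truncated difference from \<open>j\<close> is convex; at
        \<open>t\<close> one neighbour is nearer to \<open>0\<close>, which gives
        strictness.\<close>
      then have "y + z \<le> 2 * c" "y + z \<le> 2 * (n - c)" using Suc c by auto
      then have concave: "y + z \<le> 2 * x" by (simp add: x_def min_def)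
      moreover have "x = j \<and> (y < j \<or> z < j)" if "c = t"
      proof -
        have "x = j" using that by (simp add: x_def j_def)
        moreover have "x = c \<or> x = n - c" by (simp add: x_def min_def)
        ultimately show ?thesis using \<open>y \<le> n - Suc c\<close> \<open>z \<le> b\<close> Suc c by auto
      qed
      ultimately show ?thesis by auto
    qed
    then show ?thesis
      unfolding lap by linarith
  qed
  then show "\<exists>f. (\<forall>c\<in>pverts (cycle_graph n).
        0 \<le> (if c = 0 then 2 else 0) - laplacian (cycle_graph n) f c) \<and>
      0 < (if t = 0 then 2 else 0) - laplacian (cycle_graph n) f t"
    using t by (intro exI[of _ f]) auto
qed

text \<open>Walking forward from \<open>s\<close> eventually reaches \<open>t\<close>, so some step
  leaves \<open>U\<close>.\<close>

lemma cycle_graph_leave: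
  assumes "s < n" "s \<in> U" "t < n" "t \<notin> U"
  shows "\<exists>p<n. p \<in> U \<and> Suc p mod n \<notin> U"
proof (rule ccontr)
  assume "\<not> ?thesis"
  then have closed: "Suc p mod n \<in> U" if "p < n" "p \<in> U" for p
    using that by blast
  have "(s + k) mod n \<in> U" for k
  proof (induction k)
    case (Suc k)
    then show ?case
      using closed[of "(s + k) mod n"] assms(1) by (simp add: mod_Suc_eq)
  qed (use assms in simp)
  \<comment> \<open>Modulo \<open>n\<close>, this many steps lead from \<open>s\<close> to
    \<open>t\<close>, even if \<open>t < s\<close>.\<close>
  from this[of "n - s + t"] show False
    using assms by simp
qed

text \<open>The cycle leaves \<open>U\<close> after \<open>p\<close> and enters it after
  \<open>q\<close>; the entering arc reversed is a second arc out of \<open>U\<close>.\<close>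

lemma card_cut_arcs_cycle_graph:
  assumes n: "3 \<le> n" and st: "s < n" "s \<in> U" "t < n" "t \<notin> U"
  shows "2 \<le> card (cut_arcs (cycle_graph n) U)"
proof -
  interpret pair_graph "cycle_graph n" by (rule pair_graph_cycle_graph[OF n])
  obtain p where p: "p < n" "p \<in> U" "Suc p mod n \<notin> U"
    using cycle_graph_leave[OF st] by blast
  obtain q where q: "q < n" "q \<notin> U" "Suc q mod n \<in> U"
    using cycle_graph_leave[of t n "- U" s] st by auto
  \<comment> \<open>Equality would make \<open>q\<close> congruent to \<open>q + 2\<close> modulo
    \<open>n\<close>, impossible for \<open>n \<ge> 3\<close>.\<close>
  have "(p, Suc p mod n) \<noteq> (Suc q mod n, q)"
  proof
    assume eq: "(p, Suc p mod n) = (Suc q mod n, q)"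
    then show False
      using n q(1) by (auto simp: mod_Suc split: if_splits)
  qed
  then have "2 = card {(p, Suc p mod n), (Suc q mod n, q)}" by simp
  also have "\<dots> \<le> card (cut_arcs (cycle_graph n) U)"
  proof (rule card_mono)
    show "finite (cut_arcs (cycle_graph n) U)"
      by (rule finite_subset[OF _ pair_finite_arcs]) (auto simp: cut_arcs_def)
    show "{(p, Suc p mod n), (Suc q mod n, q)} \<subseteq> cut_arcs (cycle_graph n) U"
      using n p q by (auto simp: cut_arcs_def cycle_graph_def)
  qed
  finally show ?thesis .
qed


section \<open>The toroidal grid\<close>

lemma pverts_toroidal_grid [simp]: "pverts (toroidal_grid m n) = {..<m} \<times> {..<n}"
  by (simp add: toroidal_grid_def cartesian_product_def)

section \<open>The scramble of punctured columns\<close>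

text \<open>A cycle without one vertex is a path, hence connected.\<close>

lemma egg_punctured_column:
  assumes m: "3 \<le> m" and a: "a < m" and i: "i < n"
  shows "egg (toroidal_grid m n) (({..<m} - {a}) \<times> {i})"
  unfolding egg_def
proof (intro conjI allI impI)
  show "({..<m} - {a}) \<times> {i} \<noteq> {}"
  proof -
    have "(if a = 0 then 1 else 0) \<in> {..<m} - {a}" using m by auto
    then show ?thesis by blast
  qed
  show "({..<m} - {a}) \<times> {i} \<subseteq> pverts (toroidal_grid m n)" using i by auto
  fix A
  let ?E = "({..<m} - {a}) \<times> {i}"
  assume mixed: "A \<inter> ?E \<noteq> {}" "\<not> ?E \<subseteq> A"
  have arc: "((p, i), (Suc p mod m, i)) \<in> parcs (toroidal_grid m n)"
    "((Suc p mod m, i), (p, i)) \<in> parcs (toroidal_grid m n)" if "p < m" for p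
    using that i m by (auto simp: toroidal_grid_def cartesian_product_def cycle_graph_def)
  let ?B = "{r. (r, i) \<in> A}"
  obtain s t where s: "s < m" "s \<noteq> a" "s \<in> ?B" and t: "t < m" "t \<noteq> a" "t \<notin> ?B"
    using mixed by auto
  \<comment> \<open>Adjoining \<open>a\<close> keeps the successor of \<open>p\<close> away from
    \<open>a\<close>; only \<open>p = a\<close> can spoil the arc.\<close>
  obtain p where p: "p < m" "p \<in> insert a ?B" "Suc p mod m \<notin> insert a ?B"
    using cycle_graph_leave[of a m "insert a ?B" t] a t by blast
  have in_E: "(Suc r mod m, i) \<in> ?E" if "Suc r mod m \<noteq> a" for r
    using that m by simp
  show "\<exists>u\<in>?E \<inter> A. \<exists>v\<in>?E - A. (u, v) \<in> parcs (toroidal_grid m n)"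
  proof (cases "p = a")
    case False
    then show ?thesis
      using p arc(1)[OF p(1)] in_E[of p]
      by (intro bexI[of _ "(p, i)"] bexI[of _ "(Suc p mod m, i)"]) auto
  next
    case True
    \<comment> \<open>Now the successor of \<open>a\<close> is outside \<open>?B\<close>, so this
      entry into \<open>?B - {a}\<close> does not start at \<open>a\<close>; its reverse is the arc
      sought.\<close>
    obtain q where q: "q < m" "q \<notin> ?B - {a}" "Suc q mod m \<in> ?B - {a}"
      using cycle_graph_leave[of t m "- (?B - {a})" s] s t by auto
    then have "q \<noteq> a" using p(3) True by auto
    then show ?thesis
      using q arc(2)[OF q(1)] in_E[of q]
      by (intro bexI[of _ "(Suc q mod m, i)"] bexI[of _ "(q, i)"]) auto
  qed
qed

lemma card_ge_disjoint_family:
  assumes "finite B" "\<And>i. i < N \<Longrightarrow> A i \<subseteq> B" "\<And>i. i < N \<Longrightarrow> k \<le> card (A i)"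
    "disjoint_family_on A {..<N}"
  shows "N * k \<le> card B"
proof -
  have fin: "finite (A i)" if "i < N" for i using assms(1,2) that finite_subset by metis
  have "N * k = (\<Sum>i<N. k)" by simp
  also have "\<dots> \<le> (\<Sum>i<N. card (A i))" using assms(3) by (intro sum_mono) auto
  also have "\<dots> = card (\<Union>i<N. A i)"
    using fin assms(4)
    by (intro card_UN_disjoint[symmetric]) (auto simp: disjoint_family_on_def)
  also have "\<dots> \<le> card B" using assms(1,2) by (intro card_mono) auto
  finally show ?thesis .
qed

text \<open>Once \<open>x\<close> is found in a column, the egg punctured at \<open>x\<close> itself
  forces a second vertex there.\<close>

lemma hitting_punctured_columns:
  fixes m n :: nat
  assumes m: "0 < m" and A: "A \<subseteq> {..<m} \<times> {..<n}"
    and hit: "\<And>a i. a < m \<Longrightarrow> i < n \<Longrightarrow> (({..<m} - {a}) \<times> {i}) \<inter> A \<noteq> {}"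
  shows "n * 2 \<le> card A"
proof (rule card_ge_disjoint_family[where A = "\<lambda>i. A \<inter> UNIV \<times> {i}"])
  show fin: "finite A" using A by (rule finite_subset) simp
  fix i assume i: "i < n"
  obtain x where x: "x < m" "(x, i) \<in> A" using hit[OF m i] by auto
  obtain y where y: "y \<noteq> x" "(y, i) \<in> A" using hit[OF x(1) i] by auto
  have "2 = card {(x, i), (y, i)}" using y by simp
  also have "\<dots> \<le> card (A \<inter> UNIV \<times> {i})" using fin x y by (intro card_mono) auto
  finally show "2 \<le> card (A \<inter> UNIV \<times> {i})" .
qed (auto simp: disjoint_family_on_def)

text \<open>Every row or column split by \<open>U\<close> contributes two cut arcs, and different
  lines share none; so the \<open>m\<close> rows are assigned distinct split lines.\<close>

lemma cut_punctured_columns: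
  assumes mn: "3 \<le> m" "3 \<le> n" and ij: "i < n" "j < n" and ab: "a < m" "b < m"
    and U: "({..<m} - {a}) \<times> {i} \<subseteq> U" "(({..<m} - {b}) \<times> {j}) \<inter> U = {}"
  shows "m * 2 \<le> card (cut_arcs (toroidal_grid m n) U)"
proof -
  interpret T: pair_graph "toroidal_grid m n" by (rule pair_graph_toroidal_grid[OF mn])
  \<comment> \<open>Row \<open>x\<close> avoids both punctures, so \<open>(x, i)\<close> is in
    \<open>U\<close> and \<open>(x, j)\<close> is not; these vertices later witness that a
    substitute column is split.\<close>
  obtain x where x: "x < m" "x \<noteq> a" "x \<noteq> b"
  proof -
    have "\<not> {..<m} \<subseteq> {a, b}"
    proof
      assume "{..<m} \<subseteq> {a, b}"
      then have "card {..<m} \<le> card {a, b}" by (rule card_mono[rotated]) simp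
      also have "\<dots> \<le> 2" by (simp add: card_insert_if)
      finally show False using mn by simp
    qed
    then show thesis using that by blast
  qed
  have xi: "(x, i) \<in> U" and xj: "(x, j) \<notin> U" using x U by auto
  have "i \<noteq> j" using xi xj by blast
  define row where "row r = (\<lambda>(y, z). ((r, y), (r, z))) ` cut_arcs (cycle_graph n) {c. (r, c) \<in> U}" for r
  define col where "col c = (\<lambda>(y, z). ((y, c), (z, c))) ` cut_arcs (cycle_graph m) {r. (r, c) \<in> U}" for c
  have card_row: "2 \<le> card (row r)" if "y < n" "(r, y) \<in> U" "z < n" "(r, z) \<notin> U" for r y z
    using card_cut_arcs_cycle_graph[OF mn(2), of y "{c. (r, c) \<in> U}" z] that
    unfolding row_def by (subst card_image) (auto simp: inj_on_def)
  have card_col: "2 \<le> card (col c)" if "y < m" "(y, c) \<in> U" "z < m" "(z, c) \<notin> U" for c y z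
    using card_cut_arcs_cycle_graph[OF mn(1), of y "{r. (r, c) \<in> U}" z] that
    unfolding col_def by (subst card_image) (auto simp: inj_on_def)
  have row_sub: "row r \<subseteq> cut_arcs (toroidal_grid m n) U" if "r < m" for r
    using that by (auto simp: row_def cut_arcs_def toroidal_grid_def cartesian_product_def)
  have col_sub: "col c \<subseteq> cut_arcs (toroidal_grid m n) U" if "c < n" for c
    using that by (auto simp: col_def cut_arcs_def toroidal_grid_def cartesian_product_def)
  have row_row: "row r \<inter> row r' = {}" if "r \<noteq> r'" for r r' using that by (auto simp: row_def)
  have row_col: "row r \<inter> col c = {}" for r c by (auto simp: row_def col_def cut_arcs_def)
  have col_col: "col i \<inter> col j = {}" using \<open>i \<noteq> j\<close> by (auto simp: col_def)
  \<comment> \<open>Row \<open>r\<close> can only lie inside \<open>U\<close> if \<open>r = b\<close>, and only miss \<open>U\<close> if \<open>r = a\<close>; it then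
    splits column \<open>j\<close>, respectively \<open>i\<close>, which substitutes for the row.\<close>
  define line where "line r =
    (if (\<exists>c<n. (r, c) \<in> U) \<and> (\<exists>c<n. (r, c) \<notin> U) then row r
     else if (r, i) \<in> U then col j else col i)" for r
  have line_cases: "line r = row r \<and> 2 \<le> card (row r) \<or>
      line r = col j \<and> 2 \<le> card (col j) \<and> r = b \<or>
      line r = col i \<and> 2 \<le> card (col i) \<and> r = a" if r: "r < m" for r
  proof (cases "(\<exists>c<n. (r, c) \<in> U) \<and> (\<exists>c<n. (r, c) \<notin> U)")
    case True
    then show ?thesis using card_row by (auto simp: line_def)
  next
    case not_mixed: False
    show ?thesis
    proof (cases "(r, i) \<in> U")
      case True
      then have "(r, j) \<in> U" using not_mixed ij by blast
      moreover from this have "r = b" using U(2) r by auto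
      ultimately show ?thesis
        using card_col[of r j x] r x(1) xj not_mixed True by (auto simp: line_def)
    next
      case False
      then have "r = a" using U(1) r by auto
      then show ?thesis
        using card_col[of x i r] r x(1) xi not_mixed False by (auto simp: line_def)
    qed
  qed
  show ?thesis
  proof (rule card_ge_disjoint_family[where A = line])
    show "finite (cut_arcs (toroidal_grid m n) U)"
      by (rule finite_subset[OF _ T.pair_finite_arcs]) (auto simp: cut_arcs_def)
    show "line r \<subseteq> cut_arcs (toroidal_grid m n) U" "2 \<le> card (line r)" if "r < m" for r
      using line_cases[OF that] row_sub[OF that] col_sub ij by auto
    show "disjoint_family_on line {..<m}"
      unfolding disjoint_family_on_def
    proof (intro ballI impI)
      \<comment> \<open>Column \<open>j\<close> replaces only row \<open>b\<close> and column
        \<open>i\<close> only row \<open>a\<close>, so no line is used twice.\<close>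
      fix r r' assume "r \<in> {..<m}" "r' \<in> {..<m}" "r \<noteq> r'"
      then show "line r \<inter> line r' = {}"
        using line_cases[of r] line_cases[of r'] row_row[of r r'] row_col[of r] row_col[of r'] col_col
        by (metis Int_commute lessThan_iff)
    qed
  qed
qed

lemma gonality_toroidal_grid_if_le:
  assumes mn: "3 \<le> m" "m \<le> n"
  shows "gonality (toroidal_grid m n) = 2 * int m"
proof -
  have n: "3 \<le> n" using mn by simp
  have G: "pair_graph (toroidal_grid m n)" by (rule pair_graph_toroidal_grid[OF mn(1) n])
  have "(0, 0) \<in> pverts (toroidal_grid m n)" using mn n by simp
  then have V: "pverts (toroidal_grid m n) \<noteq> {}" by blast
  show ?thesis
    unfolding gonality_eq_Least[OF G V]
  proof (rule Least_equality)
    let ?d = "\<lambda>c :: nat. if c = 0 then 2 else 0 :: int"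
    have "positive_rank (toroidal_grid m n) (\<lambda>v. ?d (snd v))"
      unfolding toroidal_grid_def
      by (intro positive_rank_cartesian_product pair_graph_cycle_graph positive_rank_cycle_graph mn(1) n)
    moreover have "(\<Sum>v\<in>pverts (toroidal_grid m n). ?d (snd v)) = 2 * int m"
    proof -
      have "(\<Sum>v\<in>pverts (toroidal_grid m n). ?d (snd v)) = (\<Sum>r<m. \<Sum>c<n. ?d c)"
        unfolding pverts_toroidal_grid sum.cartesian_product by (simp add: case_prod_beta)
      then show ?thesis using n by simp
    qed
    ultimately show "\<exists>d. positive_rank (toroidal_grid m n) d \<and>
        (\<Sum>v\<in>pverts (toroidal_grid m n). d v) = 2 * int m" by blast
  next
    fix k
    assume "\<exists>d. positive_rank (toroidal_grid m n) d \<and> (\<Sum>v\<in>pverts (toroidal_grid m n). d v) = k"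
    then obtain d where d: "positive_rank (toroidal_grid m n) d"
      "(\<Sum>v\<in>pverts (toroidal_grid m n). d v) = k" by blast
    let ?S = "{({..<m} - {a}) \<times> {i} | a i. a < m \<and> i < n}"
    have "int (m * 2) \<le> (\<Sum>v\<in>pverts (toroidal_grid m n). d v)"
    proof (rule scramble_order_le_degree[OF G V d(1), where S = ?S])
      show "egg (toroidal_grid m n) E" if "E \<in> ?S" for E
        using that egg_punctured_column[OF mn(1)] by blast
    next
      fix A assume A: "A \<subseteq> pverts (toroidal_grid m n)" "\<And>E. E \<in> ?S \<Longrightarrow> E \<inter> A \<noteq> {}"
      have "n * 2 \<le> card A"
        using mn A by (intro hitting_punctured_columns[of m]) auto
      \<comment> \<open>Here \<open>m \<le> n\<close> enters: the bound \<open>2 n\<close> from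
        hitting is at least \<open>2 m\<close>.\<close>
      then show "int (m * 2) \<le> int (card A)" using mn(2) by linarith
    next
      fix E E' U assume "E \<in> ?S" "E' \<in> ?S" "E \<subseteq> U" "E' \<inter> U = {}"
      then show "int (m * 2) \<le> int (card (cut_arcs (toroidal_grid m n) U))"
        using cut_punctured_columns[OF mn(1) n] by (auto simp del: of_nat_mult)
    qed
    then show "2 * int m \<le> k" using d(2) by simp
  qed
qed

theorem theorem5p3:
  fixes m n :: nat
  assumes "3 \<le> m" and "3 \<le> n" and "\<bar>int m - int n\<bar> \<ge> 2"
  shows "gonality (toroidal_grid m n) = 2 * int (min m n)"
proof (cases "m \<le> n")
  case True
  then show ?thesis using gonality_toroidal_grid_if_le[of m n] assms by simp
next
  case False
  have "gonality (toroidal_grid m n) = gonality (toroidal_grid n m)"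
    unfolding toroidal_grid_def
    using assms(1,2)
    by (intro gonality_cartesian_product_commute pair_graph_cycle_graph)
      (auto simp: lessThan_empty_iff)
  then show ?thesis using gonality_toroidal_grid_if_le[of n m] assms False by simp
qed

end
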